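(* Let $\Lambda=\Lambda(b,\mathcal{F})$ be a feasible BLPR problem with $M^*<2k^*$ in which every free machine has free capacity at least $2$. Assign the free jobs arbitrarily to free machines so that each free machine receives at most $2$ free jobs; let $\mathcal{F}'$ be $\mathcal{F}$ together with all pairs $(p,j)$ with free job $j$ assigned to machine $p$, and let $b'_p=b_p+\sum_{j\text{ assigned to }p}t_j$ for each machine $p$ (the sum being empty for machines receiving no job). Then $\Lambda(b',\mathcal{F}')$ has no free jobs (all jobs are scheduled) and $\Lambda(b',\mathcal{F}')$ is feasible.
   Context: Given a positive integer $k$, positive integers $m_1,\dots,m_k$, non-negative integers $t_1,\dots,t_M$ with $M\le\sum_i m_i$, a real vector $b=(b_1,\dots,b_k)$ and a set $\mathcal{F}\subseteq\{1,\dots,k\}\times\{1,\dots,M\}$, the BLPR problem $\Lambda(b,\mathcal{F})$ is the feasibility problem in real variables $x_{ij}$ ($1\le i\le k$, $1\le j\le M$): $\sum_j x_{ij}t_j\le b_i$ and $\sum_j x_{ij}\le m_i$ for all $i$; $\sum_i x_{ij}=1$ for all $j$; $x_{ij}=1$ for $(i,j)\in\mathcal{F}$; $x_{ij}\ge0$. Let $c_i=|\{j:(i,j)\in\mathcal{F}\}|$; $m_i-c_i$ is the free capacity of machine $i$. A job $j$ is free if $(i,j)\notin\mathcal{F}$ for all $i$; a machine $i$ is free if $c_i<m_i$. $M^*$, $k^*$ are the numbers of free jobs and free machines. *)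

theory Defs
  imports Complex_Main
begin

text \<open>Machines are the indices \<open>1..k\<close> and jobs the indices \<open>1..M\<close>; the values of \<open>m\<close>, \<open>t\<close>, \<open>b\<close>
  and \<open>x\<close> outside these ranges are irrelevant.\<close>

definition blpr_data :: "nat \<Rightarrow> nat \<Rightarrow> (nat \<Rightarrow> nat) \<Rightarrow> (nat \<times> nat) set \<Rightarrow> bool" where
  "blpr_data k M m F \<longleftrightarrow>
     0 < k \<and> (\<forall>i\<in>{1..k}. 0 < m i) \<and> M \<le> (\<Sum>i=1..k. m i) \<and> F \<subseteq> {1..k} \<times> {1..M}"

definition blpr_solution ::
  "nat \<Rightarrow> nat \<Rightarrow> (nat \<Rightarrow> nat) \<Rightarrow> (nat \<Rightarrow> nat) \<Rightarrow> (nat \<Rightarrow> real) \<Rightarrow> (nat \<times> nat) set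
    \<Rightarrow> (nat \<Rightarrow> nat \<Rightarrow> real) \<Rightarrow> bool" where
  "blpr_solution k M m t b F x \<longleftrightarrow>
     (\<forall>i\<in>{1..k}. (\<Sum>j=1..M. x i j * real (t j)) \<le> b i) \<and>
     (\<forall>i\<in>{1..k}. (\<Sum>j=1..M. x i j) \<le> real (m i)) \<and>
     (\<forall>j\<in>{1..M}. (\<Sum>i=1..k. x i j) = 1) \<and>
     (\<forall>(i, j)\<in>F. x i j = 1) \<and>
     (\<forall>i\<in>{1..k}. \<forall>j\<in>{1..M}. 0 \<le> x i j)"

definition blpr_feasible ::
  "nat \<Rightarrow> nat \<Rightarrow> (nat \<Rightarrow> nat) \<Rightarrow> (nat \<Rightarrow> nat) \<Rightarrow> (nat \<Rightarrow> real) \<Rightarrow> (nat \<times> nat) set \<Rightarrow> bool" where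
  "blpr_feasible k M m t b F \<longleftrightarrow> (\<exists>x. blpr_solution k M m t b F x)"

definition fixed_count :: "(nat \<times> nat) set \<Rightarrow> nat \<Rightarrow> nat" where
  "fixed_count F i = card {j. (i, j) \<in> F}"

definition free_capacity :: "(nat \<Rightarrow> nat) \<Rightarrow> (nat \<times> nat) set \<Rightarrow> nat \<Rightarrow> int" where
  "free_capacity m F i = int (m i) - int (fixed_count F i)"

definition free_jobs :: "nat \<Rightarrow> nat \<Rightarrow> (nat \<times> nat) set \<Rightarrow> nat set" where
  "free_jobs k M F = {j \<in> {1..M}. \<forall>i\<in>{1..k}. (i, j) \<notin> F}"

definition free_machines :: "nat \<Rightarrow> (nat \<Rightarrow> nat) \<Rightarrow> (nat \<times> nat) set \<Rightarrow> nat set" where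
  "free_machines k m F = {i \<in> {1..k}. fixed_count F i < m i}"

definition assigned_jobs ::
  "nat \<Rightarrow> nat \<Rightarrow> (nat \<times> nat) set \<Rightarrow> (nat \<Rightarrow> nat) \<Rightarrow> nat \<Rightarrow> nat set" where
  "assigned_jobs k M F a p = {j \<in> free_jobs k M F. a j = p}"

text \<open>An assignment is a function \<open>a\<close> sending each free job to a free machine; only its values on
  the free jobs matter.\<close>

definition admissible_assignment ::
  "nat \<Rightarrow> nat \<Rightarrow> (nat \<Rightarrow> nat) \<Rightarrow> (nat \<times> nat) set \<Rightarrow> (nat \<Rightarrow> nat) \<Rightarrow> bool" where
  "admissible_assignment k M m F a \<longleftrightarrow>
     (\<forall>j\<in>free_jobs k M F. a j \<in> free_machines k m F) \<and>
     (\<forall>p\<in>free_machines k m F. card (assigned_jobs k M F a p) \<le> 2)"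

definition extended_fixed ::
  "nat \<Rightarrow> nat \<Rightarrow> (nat \<times> nat) set \<Rightarrow> (nat \<Rightarrow> nat) \<Rightarrow> (nat \<times> nat) set" where
  "extended_fixed k M F a = F \<union> {(p, j). j \<in> free_jobs k M F \<and> a j = p}"

definition extended_bound ::
  "nat \<Rightarrow> nat \<Rightarrow> (nat \<Rightarrow> nat) \<Rightarrow> (nat \<Rightarrow> real) \<Rightarrow> (nat \<times> nat) set \<Rightarrow> (nat \<Rightarrow> nat) \<Rightarrow> nat \<Rightarrow> real" where
  "extended_bound k M t b F a p = b p + (\<Sum>j\<in>assigned_jobs k M F a p. real (t j))"

end

theory Submission
  imports Defs
begin

text \<open>Once every job is fixed, the only candidate solution is the 0/1 indicator of the fixed pairs.
  A solution \<open>x\<close> of the original problem equals 1 on \<open>F\<close> and is nonnegative, so it dominates the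
  indicator of \<open>F\<close>; hence the fixed jobs alone respect all loads \<open>b i\<close> and capacities \<open>m i\<close>, and no job
  is fixed twice. The assigned jobs are paid for by the increase of the bounds and by the free
  capacity 2. Since there are fewer than \<open>2 k*\<close> free jobs, an admissible assignment exists.\<close>

text \<open>Enumerate \<open>J\<close> from 0 and cut the enumeration into consecutive blocks of
  length \<open>n\<close>; block \<open>r\<close> is sent to the \<open>r\<close>-th element of
  \<open>P\<close>. The cardinality bound ensures that \<open>card P\<close> blocks are
  enough.\<close>

lemma exists_map_fibres_le:
  assumes "finite J" "finite P" "card J \<le> n * card P"
  shows "\<exists>a. a ` J \<subseteq> P \<and> (\<forall>p\<in>P. card {j \<in> J. a j = p} \<le> n)"
proof -
  obtain f where f: "bij_betw f J {0..<card J}"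
    using ex_bij_betw_finite_nat[OF assms(1)] by blast
  obtain h where h: "bij_betw h {0..<card P} P"
    using ex_bij_betw_nat_finite[OF assms(2)] by blast
  let ?a = "\<lambda>j. h (f j div n)"
  have div_less: "f j div n < card P" if "j \<in> J" for j
  proof -
    have "f j < n * card P"
      using bij_betwE[OF f] that assms(3) by fastforce
    then show ?thesis
      by (simp add: less_mult_imp_div_less mult.commute)
  qed
  have "card {j \<in> J. ?a j = p} \<le> n" if p: "p \<in> P" for p
  proof -
    obtain r where r: "r < card P" "h r = p"
      using h p by (metis atLeastLessThan_iff bij_betw_def imageE)
    have "f ` {j \<in> J. ?a j = p} \<subseteq> {n * r..<n * r + n}"
    proof (rule image_subsetI)
      fix j assume "j \<in> {j \<in> J. ?a j = p}"
      then have j: "j \<in> J" "h (f j div n) = p"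
        by auto
      then have div: "f j div n = r"
        using h r div_less[of j] by (auto simp: bij_betw_def inj_on_def)
      \<comment> \<open>For \<open>n = 0\<close> the cardinality bound would make \<open>J\<close>
        empty, yet it contains \<open>j\<close>.\<close>
      have "0 < n"
        using assms j(1) by (cases n) auto
      then show "f j \<in> {n * r..<n * r + n}"
        using mult_div_mod_eq[of n "f j"] mod_less_divisor[of n "f j"]
        unfolding div atLeastLessThan_iff by linarith
    qed
    moreover have "inj_on f {j \<in> J. ?a j = p}"
      using f by (auto simp: bij_betw_def inj_on_def)
    ultimately show ?thesis
      using card_inj_on_le[of f "{j \<in> J. ?a j = p}" "{n * r..<n * r + n}"] by simp
  qed
  then show ?thesis
    using div_less bij_betwE[OF h] by (intro exI[of _ ?a]) auto
qed

text \<open>The entries at fixed pairs are 1, and the other terms of the row are nonnegative. The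
  weight \<open>w\<close> is kept general: \<open>t\<close> gives the load of the fixed jobs, the
  constant 1 their number.\<close>

lemma blpr_solution_fixed_sum_le:
  assumes "blpr_solution k M m t b F x" "F \<subseteq> {1..k} \<times> {1..M}" "i \<in> {1..k}"
    and "\<And>j. 0 \<le> w j"
  shows "(\<Sum>j | (i, j) \<in> F. w j) \<le> (\<Sum>j=1..M. x i j * w j)"
proof -
  have "(\<Sum>j | (i, j) \<in> F. w j) = (\<Sum>j | (i, j) \<in> F. x i j * w j)"
    using assms(1) by (intro sum.cong) (auto simp: blpr_solution_def)
  also have "\<dots> \<le> (\<Sum>j=1..M. x i j * w j)"
    using assms by (intro sum_mono2) (auto simp: blpr_solution_def)
  finally show ?thesis .
qed

text \<open>Two distinct machines would contribute 2 to a column whose sum is 1.\<close>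

lemma blpr_solution_fixed_unique:
  assumes "blpr_solution k M m t b F x" "F \<subseteq> {1..k} \<times> {1..M}"
    and "(i, j) \<in> F" "(i', j) \<in> F"
  shows "i = i'"
proof (rule ccontr)
  assume "i \<noteq> i'"
  have "(\<Sum>l\<in>{i, i'}. x l j) \<le> (\<Sum>l=1..k. x l j)"
    using assms by (intro sum_mono2) (auto simp: blpr_solution_def)
  moreover have "x i j = 1" "x i' j = 1" "(\<Sum>l=1..k. x l j) = 1"
    using assms by (auto simp: blpr_solution_def)
  ultimately show False
    using \<open>i \<noteq> i'\<close> by simp
qed

lemma exists_admissible_assignment:
  assumes "card (free_jobs k M F) \<le> 2 * card (free_machines k m F)"
  shows "\<exists>a. admissible_assignment k M m F a"
proof -
  have "finite (free_jobs k M F)" "finite (free_machines k m F)"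
    by (auto simp: free_jobs_def free_machines_def)
  then show ?thesis
    using exists_map_fibres_le[OF _ _ assms]
    by (auto simp: admissible_assignment_def assigned_jobs_def image_subset_iff)
qed

lemma free_jobs_extended_fixed:
  assumes "admissible_assignment k M m F a"
  shows "free_jobs k M (extended_fixed k M F a) = {}"
proof -
  have "j \<notin> free_jobs k M (extended_fixed k M F a)" for j
  proof
    assume j: "j \<in> free_jobs k M (extended_fixed k M F a)"
    then have free: "j \<in> free_jobs k M F"
      by (auto simp: free_jobs_def extended_fixed_def)
    then have "a j \<in> {1..k}"
      using assms by (auto simp: admissible_assignment_def free_machines_def)
    moreover have "(a j, j) \<in> extended_fixed k M F a"
      using free by (simp add: extended_fixed_def)
    ultimately show False
      using j by (auto simp: free_jobs_def)
  qed
  then show ?thesis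
    by blast
qed

lemma blpr_feasible_extended:
  assumes F: "F \<subseteq> {1..k} \<times> {1..M}"
    and x: "blpr_solution k M m t b F x"
    and cap: "\<forall>i\<in>free_machines k m F. 2 \<le> free_capacity m F i"
    and a: "admissible_assignment k M m F a"
  shows "blpr_feasible k M m t (extended_bound k M t b F a) (extended_fixed k M F a)"
proof -
  let ?F' = "extended_fixed k M F a" and ?A = "assigned_jobs k M F a"
  let ?y = "\<lambda>i j. of_bool ((i, j) \<in> ?F') :: real"
  have F': "?F' \<subseteq> {1..k} \<times> {1..M}"
    using F a by (auto simp: extended_fixed_def admissible_assignment_def free_machines_def
        free_jobs_def)
  \<comment> \<open>Again for arbitrary weights, so that one splitting serves both the load and the
    capacity constraint.\<close>
  have row: "(\<Sum>j=1..M. ?y i j * w j) = (\<Sum>j | (i, j) \<in> F. w j) + (\<Sum>j\<in>?A i. w j)"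
    if i: "i \<in> {1..k}" for i and w :: "nat \<Rightarrow> real"
  proof -
    have "(\<Sum>j=1..M. ?y i j * w j) = (\<Sum>j\<in>{j \<in> {1..M}. (i, j) \<in> ?F'}. w j)"
      by (rule sum.mono_neutral_cong_right) auto
    also have "{j \<in> {1..M}. (i, j) \<in> ?F'} = {j. (i, j) \<in> F} \<union> ?A i"
      using F by (auto simp: extended_fixed_def assigned_jobs_def free_jobs_def)
    also have "(\<Sum>j\<in>{j. (i, j) \<in> F} \<union> ?A i. w j)
        = (\<Sum>j | (i, j) \<in> F. w j) + (\<Sum>j\<in>?A i. w j)"
    proof (rule sum.union_disjoint)
      show "finite {j. (i, j) \<in> F}"
        using F by (blast intro: finite_subset[OF _ finite_atLeastAtMost])
      show "finite (?A i)"
        by (simp add: assigned_jobs_def free_jobs_def)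
      \<comment> \<open>An assigned job is free, hence fixed on no machine in \<open>{1..k}\<close>;
        this is where the range of \<open>i\<close> enters.\<close>
      show "{j. (i, j) \<in> F} \<inter> ?A i = {}"
        using i by (auto simp: assigned_jobs_def free_jobs_def)
    qed
    finally show ?thesis .
  qed
  have load: "(\<Sum>j=1..M. ?y i j * real (t j)) \<le> extended_bound k M t b F a i"
    if i: "i \<in> {1..k}" for i
  proof -
    \<comment> \<open>Only the fixed jobs need a bound: the load of the assigned ones is exactly the
      increase from \<open>b\<close> to \<open>extended_bound\<close>.\<close>
    have "(\<Sum>j | (i, j) \<in> F. real (t j)) \<le> b i"
    proof (rule order_trans[OF blpr_solution_fixed_sum_le[OF x F i]])
      show "(\<Sum>j=1..M. x i j * real (t j)) \<le> b i"
        using x i unfolding blpr_solution_def by blast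
    qed simp
    then show ?thesis
      by (simp only: row[OF i] extended_bound_def)
  qed
  have capacity: "(\<Sum>j=1..M. ?y i j) \<le> real (m i)" if i: "i \<in> {1..k}" for i
  proof -
    have count: "(\<Sum>j=1..M. ?y i j) = real (fixed_count F i + card (?A i))"
      using row[OF i, of "\<lambda>_. 1"] by (simp add: fixed_count_def)
    have "fixed_count F i + card (?A i) \<le> m i"
    proof (cases "i \<in> free_machines k m F")
      case True
      with a have "card (?A i) \<le> 2"
        by (simp add: admissible_assignment_def)
      moreover have "2 \<le> free_capacity m F i"
        using cap True by blast
      ultimately show ?thesis
        by (simp add: free_capacity_def)
    next
      \<comment> \<open>Such a machine receives no job. Not being free only says
        \<open>m i \<le> fixed_count F i\<close>; the reverse inequality comes from the row sum of
        \<open>x\<close>.\<close>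
      case False
      then have "?A i = {}"
        using a by (auto simp: admissible_assignment_def assigned_jobs_def)
      moreover have "(\<Sum>j=1..M. x i j) \<le> real (m i)"
        using x i unfolding blpr_solution_def by blast
      then have "fixed_count F i \<le> m i"
        using blpr_solution_fixed_sum_le[OF x F i, of "\<lambda>_. 1"] by (simp add: fixed_count_def)
      ultimately show ?thesis
        by simp
    qed
    then show ?thesis
      by (simp only: count of_nat_le_iff)
  qed
  have column: "(\<Sum>i=1..k. ?y i j) = 1" if j: "j \<in> {1..M}" for j
  proof -
    obtain p where p: "p \<in> {1..k}" "(p, j) \<in> ?F'"
      using free_jobs_extended_fixed[OF a] j by (auto simp: free_jobs_def)
    \<comment> \<open>A job free in \<open>F\<close> occurs in \<open>?F'\<close> only through its
      assignment \<open>a j\<close>; any other job occurs only in pairs of \<open>F\<close>, where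
      \<open>x\<close> rules out two machines.\<close>
    have unique: "i = p" if i: "(i, j) \<in> ?F'" for i
    proof (cases "j \<in> free_jobs k M F")
      case True
      then have "(l, j) \<notin> F" for l
        using F by (auto simp: free_jobs_def)
      then show ?thesis
        using i p by (simp add: extended_fixed_def)
    next
      case False
      then have "(i, j) \<in> F" "(p, j) \<in> F"
        using i p by (auto simp: extended_fixed_def)
      then show ?thesis
        by (rule blpr_solution_fixed_unique[OF x F])
    qed
    have "(i, j) \<in> ?F' \<longleftrightarrow> i = p" for i
      using unique p(2) by blast
    then show ?thesis
      using p(1) by (simp add: of_bool_def)
  qed
  have "blpr_solution k M m t (extended_bound k M t b F a) ?F' ?y"
    unfolding blpr_solution_def
  proof (intro conjI)
    show "\<forall>i\<in>{1..k}. (\<Sum>j=1..M. ?y i j * real (t j)) \<le> extended_bound k M t b F a i"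
      using load by blast
    show "\<forall>i\<in>{1..k}. (\<Sum>j=1..M. ?y i j) \<le> real (m i)"
      using capacity by blast
    show "\<forall>j\<in>{1..M}. (\<Sum>i=1..k. ?y i j) = 1"
      using column by blast
  qed auto
  then show ?thesis
    unfolding blpr_feasible_def by blast
qed

text \<open>The existence of an admissible assignment is part of the conclusion, so the claim about
  all such assignments is not vacuous.\<close>

theorem theorem3:
  fixes k M :: nat and m t :: "nat \<Rightarrow> nat" and b :: "nat \<Rightarrow> real" and F :: "(nat \<times> nat) set"
  assumes "blpr_data k M m F"
    and "blpr_feasible k M m t b F"
    and "card (free_jobs k M F) < 2 * card (free_machines k m F)"
    and "\<forall>i\<in>free_machines k m F. 2 \<le> free_capacity m F i"
  shows "(\<exists>a. admissible_assignment k M m F a) \<and>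
    (\<forall>a. admissible_assignment k M m F a \<longrightarrow>
       free_jobs k M (extended_fixed k M F a) = {} \<and>
       blpr_feasible k M m t (extended_bound k M t b F a) (extended_fixed k M F a))"
proof -
  obtain x where x: "blpr_solution k M m t b F x"
    using assms(2) by (auto simp: blpr_feasible_def)
  have "F \<subseteq> {1..k} \<times> {1..M}"
    using assms(1) by (simp add: blpr_data_def)
  then show ?thesis
    using exists_admissible_assignment[OF less_imp_le[OF assms(3)]] free_jobs_extended_fixed
      blpr_feasible_extended[OF _ x assms(4)]
    by blast
qed

end
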